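(* Let $A\in\mathbb{R}^{m\times n}$ have full row rank, let $b\in\mathbb{R}^m\setminus\{0\}$, and let $F(x):=\frac{\|x\|_1}{\|x\|}+\delta_{A^{-1}\{b\}}(x)$. Let $\alpha>0$, let $x^0$ satisfy $Ax^0=b$, and let $\{x^t\}$ be generated by $$x^{t+1}=\mathop{\mathrm{arg\,min}}_{x\in\mathbb{R}^n}\left\{\|x\|_1-\frac{\omega_t}{\|x^t\|}\langle x,x^t\rangle+\frac{\alpha}{2}\|x-x^t\|^2:\ Ax=b\right\},\qquad \omega_t=\frac{\|x^t\|_1}{\|x^t\|},\qquad t=0,1,2,\dots$$ Suppose that $\{x^t\}$ is bounded. Then $\{x^t\}$ converges to a stationary point $x^*$ of $F$, and there exist a nonnegative integer $\underline t$, $a_0\in(0,1)$ and $a_1>0$ such that $$\|x^t-x^*\|\le a_1a_0^t\quad\text{whenever } t>\underline t.$$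
   Context: $\|\cdot\|$ is the Euclidean norm, $\|\cdot\|_1$ the $\ell_1$ norm, $A^{-1}\{b\}=\{x:Ax=b\}$, and $\delta_C$ is the indicator function of $C$ ($0$ on $C$, $\infty$ off $C$); $F(x)=\infty$ whenever $Ax\ne b$ (in particular at $x=0$, since $b\ne0$). For a proper closed $h:\mathbb{R}^n\to(-\infty,\infty]$ and $\bar x\in\mathrm{dom}\,h$, the regular subdifferential is $\widehat\partial h(\bar x)=\{v:\liminf_{x\to\bar x,x\ne\bar x}\frac{h(x)-h(\bar x)-\langle v,x-\bar x\rangle}{\|x-\bar x\|}\ge0\}$, and the limiting subdifferential is $\partial h(\bar x)=\{v:\exists\,x^t\to\bar x \text{ with } h(x^t)\to h(\bar x) \text{ and } v^t\in\widehat\partial h(x^t)\text{ with }v^t\to v\}$ (empty off $\mathrm{dom}\,h$). $\bar x$ is a stationary point of $h$ if $0\in\partial h(\bar x)$. *)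

theory Defs
  imports "HOL-Analysis.Analysis"
begin

definition l1norm :: "real ^ 'n \<Rightarrow> real" where
  "l1norm x = (\<Sum>i\<in>UNIV. \<bar>x $ i\<bar>)"

definition indicator_fun :: "'a set \<Rightarrow> 'a \<Rightarrow> ereal" where
  "indicator_fun C x = (if x \<in> C then 0 else \<infinity>)"

(* The intended arguments of the following definitions never take the value
   -\<infinity>, so on the effective domain h is real-valued. *)

definition effective_dom :: "('a \<Rightarrow> ereal) \<Rightarrow> 'a set" where
  "effective_dom h = {x. h x < \<infinity>}"

(* The filter "at xbar" excludes xbar, so the quotient is only taken at x \<noteq> xbar. *)

definition regular_subdiff :: "('a::euclidean_space \<Rightarrow> ereal) \<Rightarrow> 'a \<Rightarrow> 'a set" where
  "regular_subdiff h xbar =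
     {v. xbar \<in> effective_dom h \<and>
         0 \<le> Liminf (at xbar)
               (\<lambda>x. (h x - h xbar - ereal (v \<bullet> (x - xbar))) / ereal (norm (x - xbar)))}"

definition limiting_subdiff :: "('a::euclidean_space \<Rightarrow> ereal) \<Rightarrow> 'a \<Rightarrow> 'a set" where
  "limiting_subdiff h xbar =
     {v. xbar \<in> effective_dom h \<and>
         (\<exists>(x :: nat \<Rightarrow> 'a) (w :: nat \<Rightarrow> 'a).
            x \<longlonglongrightarrow> xbar \<and> (\<lambda>t. h (x t)) \<longlonglongrightarrow> h xbar \<and>
            (\<forall>t. w t \<in> regular_subdiff h (x t)) \<and> w \<longlonglongrightarrow> v)}"

definition stationary_point :: "('a::euclidean_space \<Rightarrow> ereal) \<Rightarrow> 'a \<Rightarrow> bool" where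
  "stationary_point h xbar \<longleftrightarrow> 0 \<in> limiting_subdiff h xbar"

(* If b \<noteq> 0 then x = 0 is infeasible and F takes the value \<infinity> there,
   whatever value the convention 0 / 0 = 0 gives to the first summand. *)

definition F_obj :: "real ^ 'n ^ 'm \<Rightarrow> real ^ 'm \<Rightarrow> real ^ 'n \<Rightarrow> ereal" where
  "F_obj A b x = ereal (l1norm x / norm x) + indicator_fun {y. A *v y = b} x"

end

theory Submission
  imports Defs
begin

text \<open>
  The iteration stops moving after finitely many steps, so the linear rate holds for trivial
  reasons. Two facts are responsible.

  First, since the iterates are bounded, every step lowers the ratio \<open>l1norm x / norm x\<close> by at
  least a fixed multiple of the squared step length (lemma \<open>prox_step_sufficient_decrease\<close>). So
  the ratios decrease to a limit \<open>w\<close>, the step lengths tend to zero, and a step that leaves the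
  ratio unchanged leaves the point unchanged.

  Second, the objective is maximal, not minimal, at a critical point of a face. On the feasible
  points with a given sign vector \<open>s\<close> the ratio is \<open>(s \<bullet> z) / norm z\<close>, which is a constant times
  the cosine of the angle between \<open>z\<close> and a fixed vector, namely the projection of \<open>s\<close> to the
  linear span of the face. If a nonnegative function of this form has a critical point, it attains
  its maximum there. If infinitely many iterates have sign vector \<open>s\<close>, then
  an accumulation point of them has ratio \<open>w\<close> and inherits criticality along the face from the
  optimality conditions of the steps, so no feasible point with sign vector \<open>s\<close> has a ratio
  above \<open>w\<close> (lemma \<open>ratio_le_limit_on_recurrent_face\<close>). Since the ratios of the iterates are
  never below \<open>w\<close>, they equal \<open>w\<close> on every sign vector that recurs. There are only
  finitely many sign vectors, hence the ratio is eventually constant and so is the iteration.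

  The limit is therefore a fixed point of a step. Its minimality in the subproblem bounds the ratio
  from below by its value at the limit up to a quadratic error, which puts \<open>0\<close> in the regular
  subdifferential (lemma \<open>prox_fixed_point_stationary\<close>).
\<close>

section \<open>Sign vectors\<close>

definition sign_vector :: "real ^ 'n \<Rightarrow> real ^ 'n" where
  "sign_vector x = (\<chi> i. sgn (x $ i))"

lemma l1norm_eq_inner_sign_vector: "l1norm x = sign_vector x \<bullet> x"
  by (simp add: l1norm_def sign_vector_def inner_vec_def abs_sgn mult.commute)

lemma l1norm_nonneg: "0 \<le> l1norm x"
  by (simp add: l1norm_def sum_nonneg)

lemma continuous_on_l1norm: "continuous_on S l1norm"
  unfolding l1norm_def by (intro continuous_intros)

lemma finite_range_sign_vector: "finite (range (sign_vector :: real ^ 'n \<Rightarrow> real ^ 'n))"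
proof (rule finite_subset)
  show "range (sign_vector :: real ^ 'n \<Rightarrow> _) \<subseteq> vec_lambda ` (UNIV \<rightarrow>\<^sub>E {-1, 0, 1::real})"
  proof (rule image_subsetI)
    fix x :: "real ^ 'n"
    have "(\<lambda>i. sgn (x $ i)) \<in> UNIV \<rightarrow>\<^sub>E {-1, 0, 1}"
      by (simp add: PiE_UNIV_domain sgn_if)
    then show "sign_vector x \<in> vec_lambda ` (UNIV \<rightarrow>\<^sub>E {-1, 0, 1::real})"
      by (auto simp: sign_vector_def)
  qed
qed (auto intro!: finite_imageI finite_PiE)

text \<open>
  A direction supported where \<open>x\<close> is nonzero can be followed both ways without leaving the
  face, so optimality along it gives an equation and not just an inequality.
\<close>

lemma sign_vector_locally_constant:
  fixes x u :: "real ^ 'n"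
  assumes "\<And>i. x $ i = 0 \<Longrightarrow> u $ i = 0"
  shows "\<forall>\<^sub>F e in nhds (0::real). sign_vector (x + e *\<^sub>R u) = sign_vector x"
proof -
  have "\<forall>\<^sub>F e in nhds (0::real). sgn (x $ i + e * u $ i) = sgn (x $ i)" for i
  proof -
    have lim: "((\<lambda>e. x $ i + e * u $ i) \<longlongrightarrow> x $ i + 0 * u $ i) (nhds 0)"
      by (intro tendsto_intros filterlim_ident)
    consider "x $ i = 0" | "x $ i > 0" | "x $ i < 0"
      by linarith
    then show ?thesis
    proof cases
      case 1
      then show ?thesis
        using assms by simp
    next
      case 2
      with order_tendstoD(1)[OF lim, of 0] show ?thesis
        by (auto elim!: eventually_mono)
    next
      case 3
      with order_tendstoD(2)[OF lim, of 0] show ?thesis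
        by (auto elim!: eventually_mono)
    qed
  qed
  then have "\<forall>\<^sub>F e in nhds (0::real). \<forall>i. sgn (x $ i + e * u $ i) = sgn (x $ i)"
    by (rule eventually_all_finite)
  then show ?thesis
    by (auto elim!: eventually_mono simp: sign_vector_def vec_eq_iff)
qed

section \<open>One step of the iteration\<close>

text \<open>
  Along a direction that vanishes wherever \<open>q\<close> does, the absolute values are linear near \<open>q\<close>, so
  the objective of the subproblem is a quadratic polynomial in the distance travelled; its
  derivative at a minimizer vanishes.
\<close>

lemma prox_step_first_order:
  fixes A :: "real ^ 'n ^ 'm" and p q u :: "real ^ 'n"
  assumes min: "is_arg_min (\<lambda>y. l1norm y - c * (y \<bullet> p) + \<alpha> / 2 * (norm (y - p))\<^sup>2)
                  (\<lambda>y. A *v y = b) q"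
    and u: "A *v u = 0" "\<And>i. q $ i = 0 \<Longrightarrow> u $ i = 0"
  shows "sign_vector q \<bullet> u = c * (p \<bullet> u) - \<alpha> * ((q - p) \<bullet> u)"
proof -
  let ?\<phi> = "\<lambda>y. l1norm y - c * (y \<bullet> p) + \<alpha> / 2 * (norm (y - p))\<^sup>2"
  let ?g = "\<lambda>e. (sign_vector q \<bullet> u - c * (p \<bullet> u) + \<alpha> * ((q - p) \<bullet> u)) * e
                + \<alpha> / 2 * (norm u)\<^sup>2 * e\<^sup>2"
  have feas: "A *v (q + e *\<^sub>R u) = b" for e
    using min u(1)
    by (simp add: is_arg_min_linorder matrix_vector_right_distrib
        matrix_vector_mult_scaleR)
  have expand: "?\<phi> (q + e *\<^sub>R u) = ?\<phi> q + ?g e"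
    if "sign_vector (q + e *\<^sub>R u) = sign_vector q" for e
  proof -
    have sq: "(norm (q + e *\<^sub>R u - p))\<^sup>2
        = (norm (q - p))\<^sup>2 + 2 * e * ((q - p) \<bullet> u) + e\<^sup>2 * (norm u)\<^sup>2"
      unfolding power2_norm_eq_inner
      by (simp add: algebra_simps inner_commute power2_eq_square)
    show ?thesis
      unfolding sq l1norm_eq_inner_sign_vector that
      by (simp add: algebra_simps inner_commute)
  qed
  have "\<forall>\<^sub>F e in nhds 0. ?g 0 \<le> ?g e"
    using sign_vector_locally_constant[OF u(2)]
  proof (rule eventually_mono)
    fix e assume "sign_vector (q + e *\<^sub>R u) = sign_vector q"
    moreover have "?\<phi> q \<le> ?\<phi> (q + e *\<^sub>R u)"
      using min feas[of e] unfolding is_arg_min_linorder by blast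
    ultimately show "?g 0 \<le> ?g e"
      using expand[of e] by simp
  qed
  then obtain d where "0 < d" "\<And>e. dist e 0 < d \<Longrightarrow> ?g 0 \<le> ?g e"
    unfolding eventually_nhds_metric by blast
  moreover have "(?g has_real_derivative
      (sign_vector q \<bullet> u - c * (p \<bullet> u) + \<alpha> * ((q - p) \<bullet> u))) (at 0)"
    by (auto intro!: derivative_eq_intros)
  ultimately have "sign_vector q \<bullet> u - c * (p \<bullet> u) + \<alpha> * ((q - p) \<bullet> u) = 0"
    by (intro DERIV_local_min[of ?g _ 0 d]) (auto simp: dist_real_def)
  then show ?thesis
    by simp
qed

text \<open>
  The current point \<open>p\<close> is feasible for its own subproblem and has objective value zero there.
  By the Cauchy--Schwarz inequality the linear term at \<open>q\<close> is at most the ratio of \<open>p\<close> times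
  \<open>norm q\<close>; dividing by \<open>norm q\<close> gives the claim.
\<close>

lemma prox_step_sufficient_decrease:
  fixes A :: "real ^ 'n ^ 'm" and p q :: "real ^ 'n"
  assumes min: "is_arg_min (\<lambda>y. l1norm y - l1norm p / norm p / norm p * (y \<bullet> p)
                    + \<alpha> / 2 * (norm (y - p))\<^sup>2) (\<lambda>y. A *v y = b) q"
    and "A *v p = b" "p \<noteq> 0" "q \<noteq> 0"
  shows "l1norm q / norm q + \<alpha> / (2 * norm q) * (norm (q - p))\<^sup>2 \<le> l1norm p / norm p"
proof -
  have "l1norm q - l1norm p / norm p / norm p * (q \<bullet> p) + \<alpha> / 2 * (norm (q - p))\<^sup>2
      \<le> l1norm p - l1norm p / norm p / norm p * (p \<bullet> p) + \<alpha> / 2 * (norm (p - p))\<^sup>2"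
    using min \<open>A *v p = b\<close> unfolding is_arg_min_linorder by blast
  also have "\<dots> = 0"
    using \<open>p \<noteq> 0\<close> by (simp add: dot_square_norm power2_eq_square)
  finally have "l1norm q + \<alpha> / 2 * (norm (q - p))\<^sup>2 \<le> l1norm p / norm p / norm p * (q \<bullet> p)"
    by simp
  also have "\<dots> \<le> l1norm p / norm p / norm p * (norm q * norm p)"
    by (intro mult_left_mono norm_cauchy_schwarz divide_nonneg_nonneg l1norm_nonneg) auto
  also have "\<dots> = l1norm p / norm p * norm q"
    using \<open>p \<noteq> 0\<close> by simp
  finally have "(l1norm q + \<alpha> / 2 * (norm (q - p))\<^sup>2) / norm q \<le> l1norm p / norm p"
    using \<open>q \<noteq> 0\<close> by (simp add: pos_divide_le_eq)
  then show ?thesis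
    by (simp add: add_divide_distrib)
qed

section \<open>Fixed points are stationary\<close>

text \<open>
  The linearization of the norm at \<open>p\<close> is exact up to second order: the difference of the
  two sides is \<open>(norm z - norm p)\<^sup>2 / (2 * norm p)\<close>.
\<close>

lemma norm_minus_inner_le:
  fixes p z :: "'a :: real_inner"
  assumes "p \<noteq> 0"
  shows "norm z - (z \<bullet> p) / norm p \<le> (norm (z - p))\<^sup>2 / (2 * norm p)"
proof -
  have "0 \<le> (norm z - norm p)\<^sup>2"
    by simp
  also have "\<dots> = (norm (z - p))\<^sup>2 - 2 * (norm z * norm p - z \<bullet> p)"
    by (simp add: power2_diff dot_norm_neg field_simps)
  finally have "norm z * norm p - z \<bullet> p \<le> (norm (z - p))\<^sup>2 / 2"
    by simp
  then have "(norm z * norm p - z \<bullet> p) / norm p \<le> (norm (z - p))\<^sup>2 / 2 / norm p"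
    by (rule divide_right_mono) simp
  then show ?thesis
    using assms by (simp add: diff_divide_distrib)
qed

text \<open>
  Minimality of \<open>p\<close> bounds \<open>l1norm z\<close> from below by \<open>w * ((z \<bullet> p) / norm p)\<close> up to a
  quadratic error, and \<open>(z \<bullet> p) / norm p\<close> agrees with \<open>norm z\<close> up to another one. After
  division by \<open>norm z\<close> the difference quotient of the objective at \<open>p\<close> is at least
  \<open>- K * norm (z - p)\<close> near \<open>p\<close>, so its lower limit is nonnegative.
\<close>

lemma prox_fixed_point_stationary:
  fixes A :: "real ^ 'n ^ 'm" and p :: "real ^ 'n"
  assumes min: "is_arg_min (\<lambda>y. l1norm y - l1norm p / norm p / norm p * (y \<bullet> p)
                    + \<alpha> / 2 * (norm (y - p))\<^sup>2) (\<lambda>y. A *v y = b) p"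
    and "p \<noteq> 0" "\<alpha> > 0"
  shows "stationary_point (F_obj A b) p"
proof -
  define w where "w = l1norm p / norm p"
  define K where "K = (\<alpha> / 2 + w / (2 * norm p)) * (2 / norm p)"
  have w: "0 \<le> w"
    by (simp add: w_def l1norm_nonneg)
  have Ap: "A *v p = b"
    using min by (simp add: is_arg_min_linorder)
  have Fp: "F_obj A b p = ereal w"
    by (simp add: F_obj_def indicator_fun_def Ap w_def)
  \<comment> \<open>The factor \<open>2 / norm p\<close> in \<open>K\<close> bounds \<open>1 / norm z\<close> where \<open>norm p / 2 < norm z\<close>.\<close>
  have growth: "w - K * (norm (z - p))\<^sup>2 \<le> l1norm z / norm z"
    if z: "A *v z = b" "norm p / 2 < norm z" for z
  proof -
    have "z \<noteq> 0"
      using z(2) by auto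
    have "l1norm p - w / norm p * (p \<bullet> p) + \<alpha> / 2 * (norm (p - p))\<^sup>2
       \<le> l1norm z - w / norm p * (z \<bullet> p) + \<alpha> / 2 * (norm (z - p))\<^sup>2"
      using min z(1) unfolding is_arg_min_linorder w_def by blast
    moreover have "w / norm p * (p \<bullet> p) = l1norm p"
      using \<open>p \<noteq> 0\<close> by (simp add: w_def dot_square_norm power2_eq_square)
    ultimately have 1: "w * ((z \<bullet> p) / norm p) - \<alpha> / 2 * (norm (z - p))\<^sup>2 \<le> l1norm z"
      by simp
    have 2: "w * (norm z - (z \<bullet> p) / norm p) \<le> w * ((norm (z - p))\<^sup>2 / (2 * norm p))"
      using w \<open>p \<noteq> 0\<close> by (intro mult_left_mono norm_minus_inner_le)
    have "(\<alpha> / 2 + w / (2 * norm p)) * (norm (z - p))\<^sup>2 * 1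
       \<le> (\<alpha> / 2 + w / (2 * norm p)) * (norm (z - p))\<^sup>2 * (2 / norm p * norm z)"
      using z(2) w \<open>\<alpha> > 0\<close> \<open>p \<noteq> 0\<close>
      by (intro mult_left_mono mult_nonneg_nonneg add_nonneg_nonneg) (auto simp: field_simps)
    then have 3: "(\<alpha> / 2 + w / (2 * norm p)) * (norm (z - p))\<^sup>2 \<le> K * (norm (z - p))\<^sup>2 * norm z"
      by (simp add: K_def mult_ac)
    have "(w - K * (norm (z - p))\<^sup>2) * norm z \<le> l1norm z"
      using 1 2 3 by (simp add: algebra_simps)
    then show ?thesis
      using \<open>z \<noteq> 0\<close> by (simp add: pos_le_divide_eq)
  qed
  have near: "\<forall>\<^sub>F z in at p. norm p / 2 < norm z"
    using \<open>p \<noteq> 0\<close> by (intro order_tendstoD(1)[OF tendsto_norm[OF tendsto_ident_at]]) auto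
  have quot: "\<forall>\<^sub>F z in at p. ereal (- K * norm (z - p))
      \<le> (F_obj A b z - F_obj A b p - ereal (0 \<bullet> (z - p))) / ereal (norm (z - p))"
    using near eventually_neq_at_within[of p p UNIV]
  proof eventually_elim
    case (elim z)
    show ?case
    proof (cases "A *v z = b")
      case True
      have "- K * norm (z - p) \<le> (l1norm z / norm z - w) / norm (z - p)"
        using growth[OF True elim(1)] elim(2)
        by (simp add: pos_le_divide_eq power2_eq_square algebra_simps)
      then show ?thesis
        using True elim(2) by (simp add: Fp) (simp add: F_obj_def indicator_fun_def)
    next
      case False
      then show ?thesis
        using elim(2) by (simp add: Fp) (simp add: F_obj_def indicator_fun_def)
    qed
  qed
  have "((\<lambda>z. ereal (- K * norm (z - p))) \<longlongrightarrow> ereal (- K * norm (p - p))) (at p)"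
    by (intro tendsto_intros)
  then have "Liminf (at p) (\<lambda>z. ereal (- K * norm (z - p))) = 0"
    by (simp add: lim_imp_Liminf zero_ereal_def)
  with Liminf_mono[OF quot] have "0 \<in> regular_subdiff (F_obj A b) p"
    by (simp add: regular_subdiff_def effective_dom_def Fp)
  \<comment> \<open>Constant sequences embed the regular into the limiting subdifferential.\<close>
  then show ?thesis
    unfolding stationary_point_def limiting_subdiff_def
    by (simp add: effective_dom_def Fp, intro exI[of _ "\<lambda>_. p"] conjI exI[of _ "\<lambda>_. 0"])
      (simp_all add: Fp)
qed

section \<open>Faces that are visited infinitely often\<close>

text \<open>
  Here \<open>p k\<close> and \<open>q k\<close> are the points before and after a step, along a subsequence whose new
  points share one sign vector. In the limit the proximal term disappears from the first-order
  condition, which then says that \<open>s - (\<omega> / norm r) *\<^sub>R r\<close> is orthogonal to \<open>z - r\<close>. It is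
  also orthogonal to \<open>r\<close>, so \<open>l1norm z = \<omega> / norm r * (r \<bullet> z)\<close>, and the Cauchy--Schwarz
  inequality finishes. The limit \<open>r\<close> may have more zero entries than \<open>s\<close>. Therefore the
  directions \<open>z - q k\<close> are used before the limit is taken: they satisfy the support condition at
  \<open>q k\<close>, while \<open>z - r\<close> need not satisfy it at \<open>r\<close>.
\<close>

lemma ratio_le_limit_on_recurrent_face:
  fixes A :: "real ^ 'n ^ 'm" and p q :: "nat \<Rightarrow> real ^ 'n"
  assumes q: "q \<longlonglongrightarrow> r" and p: "p \<longlonglongrightarrow> r" and w: "w \<longlonglongrightarrow> \<omega>"
    and ratio: "\<And>k. w k = l1norm (p k) / norm (p k)"
    and step: "\<And>k. is_arg_min (\<lambda>y. l1norm y - w k / norm (p k) * (y \<bullet> p k)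
                     + \<alpha> / 2 * (norm (y - p k))\<^sup>2) (\<lambda>y. A *v y = b) (q k)"
    and face: "\<And>k. sign_vector (q k) = s"
    and "b \<noteq> 0" and z: "A *v z = b" "sign_vector z = s"
  shows "l1norm z / norm z \<le> \<omega>"
proof -
  have Aq: "A *v q k = b" for k
    using step[of k] by (simp add: is_arg_min_linorder)
  have "(\<lambda>k. A *v q k) \<longlonglongrightarrow> A *v r"
    by (intro bounded_linear.tendsto[OF matrix_vector_mul_bounded_linear] q)
  then have Ar: "A *v r = b"
    by (simp add: Aq LIMSEQ_const_iff)
  then have "r \<noteq> 0" "z \<noteq> 0"
    using \<open>b \<noteq> 0\<close> z(1) by auto
  have l1: "(\<lambda>k. l1norm (v k)) \<longlonglongrightarrow> l1norm r" if "v \<longlonglongrightarrow> r" for v :: "nat \<Rightarrow> real ^ 'n"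
    using continuous_on_tendsto_compose[OF continuous_on_l1norm[of UNIV] that] by simp
  have "(\<lambda>k. l1norm (p k) / norm (p k)) \<longlonglongrightarrow> l1norm r / norm r"
    by (intro tendsto_intros l1 p) (use \<open>r \<noteq> 0\<close> in auto)
  then have \<omega>: "\<omega> = l1norm r / norm r"
    unfolding ratio[symmetric] by (rule LIMSEQ_unique[OF w])
  have sr: "l1norm r = s \<bullet> r"
  proof (rule LIMSEQ_unique[OF l1[OF q]])
    have "(\<lambda>k. s \<bullet> q k) \<longlonglongrightarrow> s \<bullet> r"
      by (intro tendsto_intros q)
    then show "(\<lambda>k. l1norm (q k)) \<longlonglongrightarrow> s \<bullet> r"
      by (simp add: l1norm_eq_inner_sign_vector face)
  qed
  have supp: "v $ i = 0 \<longleftrightarrow> s $ i = 0" if "sign_vector v = s" for v i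
    using that by (auto simp: sign_vector_def sgn_eq_0_iff)
  have "(z - q k) $ i = 0" if "q k $ i = 0" for i k
    using that supp[OF face, of k i] supp[OF z(2), of i] by auto
  then have first_order: "s \<bullet> (z - q k) = w k / norm (p k) * (p k \<bullet> (z - q k))
      - \<alpha> * ((q k - p k) \<bullet> (z - q k))" for k
    using prox_step_first_order[OF step[of k], of "z - q k"] face z(1) Aq
    by (simp add: matrix_vector_mult_diff_distrib del: vector_minus_component)
  have lim: "(\<lambda>k. w k / norm (p k) * (p k \<bullet> (z - q k)) - \<alpha> * ((q k - p k) \<bullet> (z - q k)))
      \<longlonglongrightarrow> \<omega> / norm r * (r \<bullet> (z - r)) - \<alpha> * ((r - r) \<bullet> (z - r))"
    by (intro tendsto_intros w p q) (use \<open>r \<noteq> 0\<close> in auto)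
  have "(\<lambda>k. s \<bullet> (z - q k)) \<longlonglongrightarrow> s \<bullet> (z - r)"
    by (intro tendsto_intros q)
  from LIMSEQ_unique[OF this lim[folded first_order]]
  have "s \<bullet> (z - r) = \<omega> / norm r * (r \<bullet> (z - r))"
    by simp
  moreover have "\<omega> / norm r * (r \<bullet> r) = s \<bullet> r"
    using \<open>r \<noteq> 0\<close> by (simp add: \<omega> sr dot_square_norm power2_eq_square)
  ultimately have "l1norm z = \<omega> / norm r * (r \<bullet> z)"
    by (simp add: l1norm_eq_inner_sign_vector z(2) inner_diff_right right_diff_distrib)
  also have "\<dots> \<le> \<omega> / norm r * (norm r * norm z)"
    by (intro mult_left_mono norm_cauchy_schwarz) (simp add: \<omega> l1norm_nonneg)
  also have "\<dots> = \<omega> * norm z"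
    using \<open>r \<noteq> 0\<close> by simp
  finally show ?thesis
    using \<open>z \<noteq> 0\<close> by (simp add: pos_divide_le_eq)
qed

section \<open>Convergence\<close>

theorem theorem4p5:
  fixes A :: "real ^ 'n ^ 'm" and b :: "real ^ 'm"
    and \<alpha> :: real and \<omega> :: "nat \<Rightarrow> real" and x :: "nat \<Rightarrow> real ^ 'n"
  assumes full_row_rank: "rank A = CARD('m)"
    and b_nonzero: "b \<noteq> 0"
    and alpha_pos: "\<alpha> > 0"
    and x0_feasible: "A *v x 0 = b"
    and omega: "\<And>t. \<omega> t = l1norm (x t) / norm (x t)"
    and x_step: "\<And>t. is_arg_min
          (\<lambda>y. l1norm y - \<omega> t / norm (x t) * (y \<bullet> x t) + \<alpha> / 2 * (norm (y - x t))\<^sup>2)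
          (\<lambda>y. A *v y = b) (x (Suc t))"
    and x_bounded: "bounded (range x)"
  shows "\<exists>xstar. x \<longlonglongrightarrow> xstar \<and> stationary_point (F_obj A b) xstar \<and>
           (\<exists>(t0 :: nat) (a0 :: real) (a1 :: real). 0 < a0 \<and> a0 < 1 \<and> 0 < a1 \<and>
              (\<forall>t > t0. norm (x t - xstar) \<le> a1 * a0 ^ t))"
proof -
  have feas: "A *v x t = b" for t
    using x0_feasible x_step by (cases t) (auto simp: is_arg_min_linorder)
  then have nz: "x t \<noteq> 0" for t
    using b_nonzero by (metis matrix_vector_mult_0_right)
  obtain M where M: "0 < M" "\<And>t. norm (x t) \<le> M"
    using x_bounded by (auto simp: bounded_pos)

  have decrease: "\<alpha> / (2 * M) * (norm (x (Suc t) - x t))\<^sup>2 \<le> \<omega> t - \<omega> (Suc t)" for t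
  proof -
    have "\<alpha> / (2 * M) * (norm (x (Suc t) - x t))\<^sup>2
        \<le> \<alpha> / (2 * norm (x (Suc t))) * (norm (x (Suc t) - x t))\<^sup>2"
      using alpha_pos M nz by (intro mult_right_mono divide_left_mono) auto
    also have "\<dots> \<le> \<omega> t - \<omega> (Suc t)"
      using prox_step_sufficient_decrease[OF x_step[of t, unfolded omega] feas nz nz]
      by (simp add: omega)
    finally show ?thesis .
  qed
  have "decseq \<omega>"
  proof (rule decseq_SucI)
    fix t
    have "0 \<le> \<alpha> / (2 * M) * (norm (x (Suc t) - x t))\<^sup>2"
      using alpha_pos M(1) by simp
    then show "\<omega> (Suc t) \<le> \<omega> t"
      using decrease[of t] by linarith
  qed
  moreover have "0 \<le> \<omega> t" for t
    by (simp add: omega l1norm_nonneg)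
  ultimately obtain w where w: "\<omega> \<longlonglongrightarrow> w" "\<And>t. w \<le> \<omega> t"
    using decseq_convergent by blast

  have "(\<lambda>t. (norm (x (Suc t) - x t))\<^sup>2) \<longlonglongrightarrow> 0"
  proof (rule tendsto_sandwich[OF _ _ tendsto_const])
    show "(\<lambda>t. 2 * M / \<alpha> * (\<omega> t - \<omega> (Suc t))) \<longlonglongrightarrow> 0"
      using tendsto_mult[OF tendsto_const[of "2 * M / \<alpha>"] tendsto_diff[OF w(1) LIMSEQ_Suc[OF w(1)]]]
      by simp
    show "\<forall>\<^sub>F t in sequentially. (norm (x (Suc t) - x t))\<^sup>2 \<le> 2 * M / \<alpha> * (\<omega> t - \<omega> (Suc t))"
      using decrease alpha_pos M(1) by (simp add: field_simps)
  qed simp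
  then have step0: "(\<lambda>t. x (Suc t) - x t) \<longlonglongrightarrow> 0"
    using tendsto_real_sqrt by (fastforce intro: tendsto_norm_zero_cancel)

  \<comment> \<open>If the ratio exceeded its limit infinitely often, one sign vector would recur among those
    times, and the bound on recurrent faces would contradict the excess at any one of them.\<close>
  have "finite {t. \<omega> (Suc t) \<noteq> w}"
  proof (rule ccontr)
    assume inf: "infinite {t. \<omega> (Suc t) \<noteq> w}"
    moreover have "finite ((\<lambda>t. sign_vector (x (Suc t))) ` {t. \<omega> (Suc t) \<noteq> w})"
      by (rule finite_subset[OF _ finite_range_sign_vector]) auto
    ultimately obtain t0 where t0: "\<omega> (Suc t0) \<noteq> w"
      and inf0: "infinite {t \<in> {t. \<omega> (Suc t) \<noteq> w}. sign_vector (x (Suc t)) = sign_vector (x (Suc t0))}"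
      using pigeonhole_infinite[of "{t. \<omega> (Suc t) \<noteq> w}"] by blast
    define S where "S = {t. sign_vector (x (Suc t)) = sign_vector (x (Suc t0))}"
    have "infinite S"
      by (rule infinite_super[OF _ inf0]) (auto simp: S_def)
    have "bounded (range (\<lambda>k. x (Suc (enumerate S k))))"
      by (rule bounded_subset[OF x_bounded]) auto
    then obtain r k where k: "strict_mono k"
      and r: "((\<lambda>k. x (Suc (enumerate S k))) \<circ> k) \<longlonglongrightarrow> r"
      using bounded_imp_convergent_subsequence by blast
    define \<tau> where "\<tau> = enumerate S \<circ> k"
    have \<tau>: "strict_mono \<tau>" "\<And>j. \<tau> j \<in> S"
      using strict_mono_o[OF strict_mono_enumerate[OF \<open>infinite S\<close>] k] enumerate_in_set[OF \<open>infinite S\<close>]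
      by (auto simp: \<tau>_def)
    have q: "(\<lambda>j. x (Suc (\<tau> j))) \<longlonglongrightarrow> r"
      using r by (simp add: \<tau>_def o_def)
    \<comment> \<open>The steps tend to zero, so the points before the steps have the same limit.\<close>
    have "(\<lambda>j. x (Suc (\<tau> j)) - (x (Suc (\<tau> j)) - x (\<tau> j))) \<longlonglongrightarrow> r - 0"
      by (intro tendsto_diff q LIMSEQ_subseq_LIMSEQ[OF step0 \<tau>(1), unfolded o_def])
    then have p: "(\<lambda>j. x (\<tau> j)) \<longlonglongrightarrow> r"
      by simp
    have "\<omega> (Suc t0) \<le> w"
      unfolding omega
    proof (rule ratio_le_limit_on_recurrent_face[OF q p
          LIMSEQ_subseq_LIMSEQ[OF w(1) \<tau>(1), unfolded o_def] omega x_step _ b_nonzero feas refl])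
      show "sign_vector (x (Suc (\<tau> j))) = sign_vector (x (Suc t0))" for j
        using \<tau>(2)[of j] by (simp add: S_def)
    qed
    then show False
      using t0 w(2)[of "Suc t0"] by simp
  qed
  then obtain N where N: "\<And>t. N \<le> t \<Longrightarrow> \<omega> (Suc t) = w"
    by (metis (mono_tags, lifting) finite_nat_set_iff_bounded mem_Collect_eq not_le)
  have stall: "x (Suc t) = x t" if "Suc N \<le> t" for t
  proof -
    obtain s where s: "t = Suc s" "N \<le> s"
      using \<open>Suc N \<le> t\<close> by (metis Suc_le_D Suc_le_mono)
    have "\<alpha> / (2 * M) * (norm (x (Suc t) - x t))\<^sup>2 \<le> 0"
      using decrease[of t] N[of s] N[of t] s by simp
    moreover have "0 < \<alpha> / (2 * M)"
      using alpha_pos M(1) by simp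
    ultimately have "(norm (x (Suc t) - x t))\<^sup>2 \<le> 0"
      by (metis mult_le_0_iff not_less)
    then show ?thesis
      by simp
  qed
  have const: "x t = x (Suc N)" if "Suc N \<le> t" for t
    using that by (induction t rule: dec_induct) (simp_all add: stall)

  \<comment> \<open>The error is zero from index \<open>Suc N\<close> on, so any rate will do.\<close>
  have "x \<longlonglongrightarrow> x (Suc N)"
    by (intro tendsto_eventually eventually_sequentiallyI[of "Suc N"] const)
  moreover have "stationary_point (F_obj A b) (x (Suc N))"
    using prox_fixed_point_stationary[OF x_step[of "Suc N", unfolded stall[OF order_refl] omega]]
      nz alpha_pos by blast
  moreover have "\<forall>t>N. norm (x t - x (Suc N)) \<le> 1 * (1 / 2) ^ t"
  proof (intro allI impI)
    fix t assume "N < t"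
    then have "x t = x (Suc N)"
      by (intro const) simp
    then show "norm (x t - x (Suc N)) \<le> 1 * (1 / 2) ^ t"
      by simp
  qed
  moreover have "0 < (1 / 2 :: real) \<and> (1 / 2 :: real) < 1 \<and> 0 < (1 :: real)"
    by simp
  ultimately show ?thesis
    by blast
qed

end
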